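(* Let $H$ and $K$ be two Lie rings with Lie ring structure $\star_1$ and $\star_2$, respectively. Suppose we have maps $\sigma:K\to\mathrm{Aut}(H)$, $x\mapsto\sigma_x$, $\Gamma:K\to\mathrm{End}(H)$, $x\mapsto\Gamma_x$, $f:K\times K\to H$ and $h:K\times K\to H$ (where $\mathrm{Aut}(H)$ and $\mathrm{End}(H)$ refer to automorphisms and endomorphisms of the group $H$) satisfying the following conditions for all $x,y,z\in K$ and all $a,b,c\in H$: (A) $f(1,x)=f(x,1)=1$ and $f(x,y)f(xy,z)=\sigma_x(f(y,z))f(x,yz)$; (B) $h(x,1)=h(1,x)=h(x,x)=1$; (C) $\sigma_{(x\star_2y)}(a\star_1b)=a\star_1b$; (D) $c\,\Gamma_{xy}(c)\,f(x,y)\,\big(\sigma_x(b)f(x,y)\star_1c\big)\,\sigma_{(xy)\star_2z}\big(\sigma_x(b^{-1})f(x,y)^{-1}\Gamma_z(\sigma_x(b^{-1})f(x,y)^{-1})\big)\,h(xy,z)$ $=\sigma_x\big(c\,\Gamma_y(c)\,(b\star_1c)\,\sigma_{(y\star_2z)}(b^{-1}c^{-1}\Gamma_z(b^{-1}))\,h(y,z)\big)\,f(x,y\star_2z)\,f(y\star_2z,x)^{-1}\,\sigma_{(y\star_2z)}\big(c\,\Gamma_x(c)\,h(x,z)\big)\,f(y\star_2z,x\star_2z)$; (E) $\sigma_y(c)\,f(y,z)\,\Gamma_x(\sigma_y(c)f(y,z))\,\big(a\star_1\sigma_y(c)f(y,z)\big)\,\sigma_{(x\star_2yz)}\big(a^{-1}\sigma_y(c^{-1})f(y,z)^{-1}\Gamma_{yz}(a^{-1})\big)\,h(x,yz)$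 $=\sigma_{(x\star_2y)}\Big(a^{-1}\Gamma_y(a^{-1})\,\sigma_y\big(a\,c\,\Gamma_x(c)\,(a\star_1c)\,\sigma_{(x\star_2z)}(a^{-1}c^{-1}\Gamma_z(a^{-1}))\,h(x,z)\big)\,f(y,x\star_2z)\,f(x\star_2z,y)^{-1}\Big)\,f(x\star_2y,x\star_2z)\,h(x,y)$; (F) with $P=c\,\sigma_z(a)\,f(z,x)f(x,z)^{-1}\sigma_x(c^{-1})$ and $Q=c\,\sigma_z(b)\,f(z,y)f(y,z)^{-1}\sigma_y(c^{-1})$, $\sigma_z\big(\Gamma_x(b)\,(a\star_1b)\,\sigma_{(x\star_2y)}(a^{-1}b^{-1}\Gamma_y(a^{-1}))\,h(x,y)\big)\,f(z,x\star_2y)\,f(x\star_2y,z)^{-1}$ $=c\,f(z,x)f(x,z)^{-1}f(z,y)f(y,z)^{-1}\sigma_x(c^{-1})\sigma_y(c^{-1})\,\Gamma_x(Q)\,(P\star_1Q)\,\sigma_{(x\star_2y)}\big(c^{-1}\sigma_z(a^{-1}b^{-1})f(z,x)^{-1}f(x,z)f(z,y)^{-1}f(y,z)\sigma_x(c)\sigma_y(c)\,\Gamma_y(P^{-1})\big)\,h(x,y)$; (G) putting $M_{x,y}(a,b)=a\,b\,\Gamma_x(b)\,(a\star_1b)\,\sigma_{(x\star_2y)}(a^{-1}b^{-1}\Gamma_y(a^{-1}))\,h(x,y)$, $\;C_{y,z}(b,c)=b\,\sigma_y(c)\,\sigma_z(b^{-1})\,f(y,z)\,f(z,y)^{-1}$,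 and, with $M=M_{x,y}(a,b)$ and $C=C_{y,z}(b,c)$, $$J_{x,y,z}(a,b,c)=M\,C\,(M\star_1C)\,\Gamma_{(x\star_2y)}(C)\,\sigma_{((x\star_2y)\star_2z)}\big(M^{-1}C^{-1}\Gamma_z(M^{-1})\big)\,h(x\star_2y,z),$$ and with $p=(x\star_2y)\star_2z$, $q=(y\star_2z)\star_2x$, $r=(z\star_2x)\star_2y$, $$J_{x,y,z}(a,b,c)\;\sigma_p\big(J_{y,z,x}(b,c,a)\big)\;f(p,q)\;\sigma_{pq}\big(J_{z,x,y}(c,a,b)\big)\;f(pq,r)=1.$$ Define the following two operations on $G=H\times K$: $$(a,x)\cdot(b,y)=\big(a\,\sigma_x(b)\,f(x,y),\;xy\big),$$ $$(a,x)\star(b,y)=\big(a\,b\,\Gamma_x(b)\,(a\star_1b)\,\sigma_{(x\star_2y)}(a^{-1}b^{-1}\Gamma_y(a^{-1}))\,h(x,y),\;x\star_2y\big)$$ for all $(a,x),(b,y)\in G$. Then $(G,\cdot,\star)$ is a multiplicative Lie algebra.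
   Context: Notation: ${}^xy=xyx^{-1}$. A multiplicative Lie algebra is a triple $(G,\cdot,\star)$ where $(G,\cdot)$ is a group and $\star$ is a binary operation on $G$ such that for all $x,y,z\in G$: (i) $x\star x=1$; (ii) $x\star(yz)=(x\star y)\,{}^y(x\star z)$; (iii) $(xy)\star z={}^x(y\star z)\,(x\star z)$; (iv) $((x\star y)\star{}^yz)((y\star z)\star{}^zx)((z\star x)\star{}^xy)=1$; (v) ${}^z(x\star y)=({}^zx)\star({}^zy)$. A Lie ring is a multiplicative Lie algebra whose underlying group is abelian (written multiplicatively here). In expressions such as $\sigma_x(b)f(x,y)\star_1c$, $x\star_2yz$, group multiplication binds more tightly than $\star_1,\star_2$.
   Formalization: The map σ: K → Aut(H) is additionally assumed to be a group homomorphism; for an arbitrary map the product need not be associative (e.g. H=ℝ, K=ℤ/2, trivial brackets, Γ, f, h, with σ₁ = doubling), and given (A) the conclusion forces this property. *)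

theory Defs
  imports "HOL-Algebra.Bij"
begin

record 'a mult_lie = "'a monoid" +
  star :: "['a, 'a] \<Rightarrow> 'a" (infixl "\<star>\<index>" 65)

definition conjugate :: "('a, 'm) monoid_scheme \<Rightarrow> 'a \<Rightarrow> 'a \<Rightarrow> 'a" where
  "conjugate G x y = x \<otimes>\<^bsub>G\<^esub> y \<otimes>\<^bsub>G\<^esub> inv\<^bsub>G\<^esub> x"

locale multiplicative_Lie_algebra = group G
  for G :: "('a, 'm) mult_lie_scheme" (structure) +
  assumes star_closed:
      "\<lbrakk>x \<in> carrier G; y \<in> carrier G\<rbrakk> \<Longrightarrow> x \<star> y \<in> carrier G"
    and star_self: "x \<in> carrier G \<Longrightarrow> x \<star> x = \<one>"
    and star_mult_right:
      "\<lbrakk>x \<in> carrier G; y \<in> carrier G; z \<in> carrier G\<rbrakk>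
        \<Longrightarrow> x \<star> (y \<otimes> z) = (x \<star> y) \<otimes> conjugate G y (x \<star> z)"
    and star_mult_left:
      "\<lbrakk>x \<in> carrier G; y \<in> carrier G; z \<in> carrier G\<rbrakk>
        \<Longrightarrow> (x \<otimes> y) \<star> z = conjugate G x (y \<star> z) \<otimes> (x \<star> z)"
    and star_jacobi:
      "\<lbrakk>x \<in> carrier G; y \<in> carrier G; z \<in> carrier G\<rbrakk>
        \<Longrightarrow> ((x \<star> y) \<star> conjugate G y z) \<otimes> ((y \<star> z) \<star> conjugate G z x)
              \<otimes> ((z \<star> x) \<star> conjugate G x y) = \<one>"
    and star_conjugate:
      "\<lbrakk>x \<in> carrier G; y \<in> carrier G; z \<in> carrier G\<rbrakk>
        \<Longrightarrow> conjugate G z (x \<star> y) = conjugate G z x \<star> conjugate G z y"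

locale Lie_ring = multiplicative_Lie_algebra G + comm_group G
  for G :: "('a, 'm) mult_lie_scheme" (structure)

context
  fixes H :: "('a, 'm) mult_lie_scheme" (structure)
    and K :: "('b, 'n) mult_lie_scheme"
    and \<sigma> \<Gamma> :: "'b \<Rightarrow> 'a \<Rightarrow> 'a"
    and f h :: "'b \<Rightarrow> 'b \<Rightarrow> 'a"
begin

text \<open>
  Everything below lives on \<open>H \<times> K\<close> with the operations of \<open>ext_mult_lie\<close>. The terms \<open>M\<close>,
  \<open>C\<close> and \<open>J\<close> are the \<open>H\<close>-components of \<open>(a, x) \<star> (b, y)\<close>, of the conjugate of \<open>(c, z)\<close> by
  \<open>(b, y)\<close> (using that \<open>K\<close> is abelian), and of \<open>((a, x) \<star> (b, y)) \<star> (conjugate of (c, z) by (b, y))\<close>.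

  The map \<open>\<sigma>\<close> into the automorphism group of \<open>H\<close> is meant to be a group homomorphism
  \<open>K \<rightarrow> Aut(H)\<close>: given the cocycle identity for \<open>f\<close>, associativity of the product below amounts to
  \<open>\<sigma> (x y) = \<sigma> x \<circ> \<sigma> y\<close>. No such property is required of \<open>\<Gamma>\<close>, which is a plain map into \<open>End(H)\<close>.
\<close>

definition ext_M :: "'b \<Rightarrow> 'b \<Rightarrow> 'a \<Rightarrow> 'a \<Rightarrow> 'a" where
  "ext_M x y a b =
     a \<otimes> b \<otimes> \<Gamma> x b \<otimes> (a \<star> b)
       \<otimes> \<sigma> (x \<star>\<^bsub>K\<^esub> y) (inv a \<otimes> inv b \<otimes> \<Gamma> y (inv a)) \<otimes> h x y"

definition ext_C :: "'b \<Rightarrow> 'b \<Rightarrow> 'a \<Rightarrow> 'a \<Rightarrow> 'a" where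
  "ext_C y z b c = b \<otimes> \<sigma> y c \<otimes> \<sigma> z (inv b) \<otimes> f y z \<otimes> inv (f z y)"

definition ext_J :: "'b \<Rightarrow> 'b \<Rightarrow> 'b \<Rightarrow> 'a \<Rightarrow> 'a \<Rightarrow> 'a \<Rightarrow> 'a" where
  "ext_J x y z a b c =
     (let M = ext_M x y a b; C = ext_C y z b c
      in M \<otimes> C \<otimes> (M \<star> C) \<otimes> \<Gamma> (x \<star>\<^bsub>K\<^esub> y) C
           \<otimes> \<sigma> ((x \<star>\<^bsub>K\<^esub> y) \<star>\<^bsub>K\<^esub> z) (inv M \<otimes> inv C \<otimes> \<Gamma> z (inv M))
           \<otimes> h (x \<star>\<^bsub>K\<^esub> y) z)"

definition ext_mult_lie :: "('a \<times> 'b) mult_lie" where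
  "ext_mult_lie =
     \<lparr>carrier = carrier H \<times> carrier K,
      mult = (\<lambda>(a, x) (b, y). (a \<otimes> \<sigma> x b \<otimes> f x y, x \<otimes>\<^bsub>K\<^esub> y)),
      one = (\<one>, \<one>\<^bsub>K\<^esub>),
      star = (\<lambda>(a, x) (b, y).
        (a \<otimes> b \<otimes> \<Gamma> x b \<otimes> (a \<star> b)
           \<otimes> \<sigma> (x \<star>\<^bsub>K\<^esub> y) (inv a \<otimes> inv b \<otimes> \<Gamma> y (inv a)) \<otimes> h x y,
         x \<star>\<^bsub>K\<^esub> y))\<rparr>"

end

end

theory Submission
  imports Defs
begin

text \<open>
  The long conditions on \<open>\<sigma>\<close>, \<open>\<Gamma>\<close>, \<open>f\<close> and \<open>h\<close> are \<open>H\<close>-coordinates of axioms on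
  \<open>H \<times> K\<close>, with common factors removed. The \<open>K\<close>-coordinates are no problem: the projection to \<open>K\<close>
  respects both operations, and \<open>K\<close> is a Lie ring.

  The cocycle identity makes \<open>H \<times> K\<close> a group. Since \<open>K\<close> is abelian, conjugation by \<open>(b, y)\<close> fixes
  the coordinate \<open>z\<close> of \<open>(c, z)\<close> and turns \<open>c\<close> into \<open>ext_C y z b c\<close> (\<open>conjugate_E\<close>), while the
  bracket of \<open>(a, x)\<close> and \<open>(b, y)\<close> has \<open>H\<close>-coordinate \<open>ext_M x y a b\<close>. The axioms of a multiplicative
  Lie algebra thus become identities between \<open>ext_M\<close> and \<open>ext_C\<close> in the abelian group \<open>H\<close>:

  \<^item> Distributivity on the left, \<open>M_mult_left\<close>, with \<open>(a, x) (b, y)\<close> bracketed with \<open>(c, z)\<close>. The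
    condition \<open>left_cond\<close> is the case \<open>a = \<one>\<close>. For general \<open>a\<close> both sides acquire the same extra
    factors, provided that \<open>\<sigma> (y \<star> z)\<close> fixes \<open>a \<star> c\<close>, which is what \<open>\<sigma>_star\<close> says.
  \<^item> Distributivity on the right, \<open>M_mult_right\<close>, with \<open>(a, x)\<close> bracketed with \<open>(b, y) (c, z)\<close>. The
    condition \<open>right_cond\<close> is the case \<open>b = \<one>\<close>, and again a general \<open>b\<close> contributes the same
    factors to both sides.
  \<^item> Compatibility with conjugation, \<open>C_M_distrib\<close>, which differs from \<open>conjugate_cond\<close> by the
    factor \<open>c \<otimes> \<sigma> z (a \<otimes> b) \<otimes> \<sigma> (x \<star> y) (inv c)\<close> on both sides.
  \<^item> The Jacobi identity, whose three factors have the \<open>H\<close>-coordinates \<open>ext_J\<close>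
    (\<open>star_star_conjugate_E\<close>), so that \<open>jacobi_cond\<close> is its \<open>H\<close>-coordinate as it stands.

  Finally, the bracket of \<open>(a, x)\<close> with itself vanishes because \<open>x \<star> x = \<one>\<close>: as \<open>\<sigma> \<one>\<close> is the
  identity, the two halves of \<open>ext_M x x a a\<close> are inverse to each other (\<open>M_self\<close>).
\<close>

section \<open>Conjugation in an abelian group, and the product of a Lie ring\<close>

lemma (in comm_group) conjugate_trivial:
  assumes "x \<in> carrier G" "y \<in> carrier G"
  shows "conjugate G x y = y"
  using assms by (simp add: conjugate_def m_comm[of x y] m_assoc)

lemma (in comm_group) cancel_inv_mult:
  assumes "u \<in> carrier G" "v \<in> carrier G" "w \<in> carrier G"
  shows "(inv u \<otimes> v) \<otimes> (u \<otimes> w) = v \<otimes> w"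
proof -
  have "(inv u \<otimes> v) \<otimes> (u \<otimes> w) = (inv u \<otimes> u) \<otimes> (v \<otimes> w)"
    using assms by (simp only: m_ac inv_closed m_closed)
  then show ?thesis using assms by simp
qed

context Lie_ring
begin

lemma star_mult_distrib_right:
  "\<lbrakk>x \<in> carrier G; y \<in> carrier G; z \<in> carrier G\<rbrakk> \<Longrightarrow> x \<star> (y \<otimes> z) = (x \<star> y) \<otimes> (x \<star> z)"
  by (simp add: star_mult_right conjugate_trivial star_closed)

lemma star_mult_distrib_left:
  "\<lbrakk>x \<in> carrier G; y \<in> carrier G; z \<in> carrier G\<rbrakk> \<Longrightarrow> (x \<otimes> y) \<star> z = (x \<star> z) \<otimes> (y \<star> z)"
  by (simp add: star_mult_left conjugate_trivial star_closed m_comm)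

lemma star_jacobi_abelian:
  "\<lbrakk>x \<in> carrier G; y \<in> carrier G; z \<in> carrier G\<rbrakk>
    \<Longrightarrow> ((x \<star> y) \<star> z) \<otimes> ((y \<star> z) \<star> x) \<otimes> ((z \<star> x) \<star> y) = \<one>"
  using star_jacobi[of x y z] by (simp add: conjugate_trivial)

end

section \<open>The group extension defined by a cocycle\<close>

text \<open>
  The group structure depends only on \<open>\<sigma>\<close> and \<open>f\<close>. The maps \<open>\<Gamma>\<close> and \<open>h\<close> are parameters already here
  because the operations of \<open>ext_mult_lie\<close> live in one record.
\<close>

locale cocycle_extension = H: Lie_ring H + K: Lie_ring K
  for H :: "('a, 'm) mult_lie_scheme" (structure)
    and K :: "('b, 'n) mult_lie_scheme" +
  fixes \<sigma> \<Gamma> :: "'b \<Rightarrow> 'a \<Rightarrow> 'a"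
    and f h :: "'b \<Rightarrow> 'b \<Rightarrow> 'a"
  assumes \<sigma>: "\<sigma> \<in> hom K (AutoGroup H)"
    and \<Gamma>: "\<Gamma> \<in> carrier K \<rightarrow> hom H H"
    and f: "f \<in> carrier K \<rightarrow> carrier K \<rightarrow> carrier H"
    and h: "h \<in> carrier K \<rightarrow> carrier K \<rightarrow> carrier H"
    and A1: "\<And>x. x \<in> carrier K \<Longrightarrow> f \<one>\<^bsub>K\<^esub> x = \<one> \<and> f x \<one>\<^bsub>K\<^esub> = \<one>"
    and A2: "\<And>x y z. \<lbrakk>x \<in> carrier K; y \<in> carrier K; z \<in> carrier K\<rbrakk> \<Longrightarrow>
        f x y \<otimes> f (x \<otimes>\<^bsub>K\<^esub> y) z = \<sigma> x (f y z) \<otimes> f x (y \<otimes>\<^bsub>K\<^esub> z)"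
begin

abbreviation E where "E \<equiv> ext_mult_lie H K \<sigma> \<Gamma> f h"

abbreviation M where "M \<equiv> ext_M H K \<sigma> \<Gamma> h"

abbreviation C where "C \<equiv> ext_C H \<sigma> f"

abbreviation J where "J \<equiv> ext_J H K \<sigma> \<Gamma> f h"

lemma f_closed [simp]: "\<lbrakk>x \<in> carrier K; y \<in> carrier K\<rbrakk> \<Longrightarrow> f x y \<in> carrier H"
  using f by blast

lemma h_closed [simp]: "\<lbrakk>x \<in> carrier K; y \<in> carrier K\<rbrakk> \<Longrightarrow> h x y \<in> carrier H"
  using h by blast

lemma \<sigma>_auto: "x \<in> carrier K \<Longrightarrow> \<sigma> x \<in> auto H"
  using \<sigma> by (auto simp: hom_def AutoGroup_def)

lemma \<sigma>_hom: "x \<in> carrier K \<Longrightarrow> group_hom H H (\<sigma> x)"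
  using \<sigma>_auto[of x] by unfold_locales (simp add: auto_def)

lemma \<Gamma>_hom: "x \<in> carrier K \<Longrightarrow> group_hom H H (\<Gamma> x)"
  using \<Gamma> by unfold_locales blast

lemmas \<sigma>_simps [simp] =
  group_hom.hom_closed[OF \<sigma>_hom] group_hom.hom_mult[OF \<sigma>_hom]
  group_hom.hom_inv[OF \<sigma>_hom] group_hom.hom_one[OF \<sigma>_hom]

lemmas \<Gamma>_simps [simp] =
  group_hom.hom_closed[OF \<Gamma>_hom] group_hom.hom_mult[OF \<Gamma>_hom]
  group_hom.hom_inv[OF \<Gamma>_hom] group_hom.hom_one[OF \<Gamma>_hom]

lemmas star_simps [simp] =
  H.star_closed K.star_closed H.star_self K.star_self

text \<open>
  The product of \<open>AutoGroup H\<close> is composition cut off outside the carrier, so the homomorphism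
  property of \<open>\<sigma>\<close> has to be read pointwise on \<open>carrier H\<close>.
\<close>

lemma \<sigma>_\<sigma>:
  assumes "x \<in> carrier K" "y \<in> carrier K" "a \<in> carrier H"
  shows "\<sigma> x (\<sigma> y a) = \<sigma> (x \<otimes>\<^bsub>K\<^esub> y) a"
proof -
  have "\<sigma> (x \<otimes>\<^bsub>K\<^esub> y) = \<sigma> x \<otimes>\<^bsub>AutoGroup H\<^esub> \<sigma> y"
    using assms \<sigma> by (simp add: hom_mult)
  also have "\<dots> = compose (carrier H) (\<sigma> x) (\<sigma> y)"
    using \<sigma>_auto assms by (simp add: AutoGroup_def BijGroup_def auto_def)
  finally show ?thesis using assms by (simp add: compose_eq)
qed

lemma \<sigma>_one: "a \<in> carrier H \<Longrightarrow> \<sigma> \<one>\<^bsub>K\<^esub> a = a"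
proof -
  assume a: "a \<in> carrier H"
  have "bij_betw (\<sigma> \<one>\<^bsub>K\<^esub>) (carrier H) (carrier H)"
    using \<sigma>_auto[OF K.one_closed] by (simp add: auto_def Bij_def)
  moreover have "\<sigma> \<one>\<^bsub>K\<^esub> (\<sigma> \<one>\<^bsub>K\<^esub> a) = \<sigma> \<one>\<^bsub>K\<^esub> a"
    using a by (simp add: \<sigma>_\<sigma>)
  ultimately show ?thesis
    using a by (metis K.one_closed \<sigma>_simps(1) bij_betw_def inj_on_eq_iff)
qed

lemma M_closed [simp]:
  "\<lbrakk>x \<in> carrier K; y \<in> carrier K; a \<in> carrier H; b \<in> carrier H\<rbrakk> \<Longrightarrow> M x y a b \<in> carrier H"
  by (simp add: ext_M_def)

lemma C_closed [simp]:
  "\<lbrakk>x \<in> carrier K; y \<in> carrier K; a \<in> carrier H; b \<in> carrier H\<rbrakk> \<Longrightarrow> C x y a b \<in> carrier H"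
  by (simp add: ext_C_def)

lemma E_carrier: "carrier E = carrier H \<times> carrier K"
  and E_mult: "(a, x) \<otimes>\<^bsub>E\<^esub> (b, y) = (a \<otimes> \<sigma> x b \<otimes> f x y, x \<otimes>\<^bsub>K\<^esub> y)"
  and E_one: "\<one>\<^bsub>E\<^esub> = (\<one>, \<one>\<^bsub>K\<^esub>)"
  and E_star: "(a, x) \<star>\<^bsub>E\<^esub> (b, y) = (M x y a b, x \<star>\<^bsub>K\<^esub> y)"
  by (simp_all add: ext_mult_lie_def ext_M_def)

text \<open>
  Associativity is the cocycle identity, once \<open>\<sigma> x \<circ> \<sigma> y\<close> has been replaced by
  \<open>\<sigma> (x \<otimes> y)\<close> on the third factor. For the left inverse of \<open>(a, x)\<close>, the \<open>K\<close>-coordinate must be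
  \<open>inv x\<close>, and the \<open>H\<close>-coordinate then cancels whatever the product leaves over.
\<close>

lemma group_E: "group E"
proof (rule groupI)
  fix u v w assume "u \<in> carrier E" "v \<in> carrier E" "w \<in> carrier E"
  then obtain a x b y c z where
    [simp]: "u = (a, x)" "v = (b, y)" "w = (c, z)"
      "a \<in> carrier H" "b \<in> carrier H" "c \<in> carrier H"
      "x \<in> carrier K" "y \<in> carrier K" "z \<in> carrier K"
    by (auto simp: E_carrier)
  have "a \<otimes> \<sigma> x b \<otimes> f x y \<otimes> \<sigma> (x \<otimes>\<^bsub>K\<^esub> y) c \<otimes> f (x \<otimes>\<^bsub>K\<^esub> y) z
      = a \<otimes> \<sigma> x b \<otimes> \<sigma> (x \<otimes>\<^bsub>K\<^esub> y) c \<otimes> (f x y \<otimes> f (x \<otimes>\<^bsub>K\<^esub> y) z)"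
    by (simp add: H.m_ac)
  also have "\<dots> = a \<otimes> \<sigma> x (b \<otimes> \<sigma> y c \<otimes> f y z) \<otimes> f x (y \<otimes>\<^bsub>K\<^esub> z)"
    by (simp add: A2 \<sigma>_\<sigma> H.m_assoc)
  finally show "u \<otimes>\<^bsub>E\<^esub> v \<otimes>\<^bsub>E\<^esub> w = u \<otimes>\<^bsub>E\<^esub> (v \<otimes>\<^bsub>E\<^esub> w)"
    by (simp add: E_mult K.m_assoc)
next
  fix u assume "u \<in> carrier E"
  then obtain a x where
    [simp]: "u = (a, x)" "a \<in> carrier H" "x \<in> carrier K"
    by (auto simp: E_carrier)
  show "\<one>\<^bsub>E\<^esub> \<otimes>\<^bsub>E\<^esub> u = u"
    by (simp add: E_one E_mult \<sigma>_one A1)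
  let ?b = "inv (\<sigma> (inv\<^bsub>K\<^esub> x) a \<otimes> f (inv\<^bsub>K\<^esub> x) x)"
  have "?b \<otimes> \<sigma> (inv\<^bsub>K\<^esub> x) a \<otimes> f (inv\<^bsub>K\<^esub> x) x = \<one>"
    by (subst H.m_assoc) simp_all
  then show "\<exists>v\<in>carrier E. v \<otimes>\<^bsub>E\<^esub> u = \<one>\<^bsub>E\<^esub>"
    by (intro bexI[of _ "(?b, inv\<^bsub>K\<^esub> x)"]) (simp_all add: E_one E_mult E_carrier)
qed (auto simp: E_carrier E_mult E_one)

text \<open>
  The conjugate of \<open>v\<close> by \<open>u\<close> is the unique solution \<open>w\<close> of \<open>w u = u v\<close>. Checking this
  equation avoids computing inverses in the extension, whose \<open>H\<close>-coordinates are unwieldy.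
\<close>

lemma conjugate_E:
  assumes [simp]: "b \<in> carrier H" "c \<in> carrier H" "y \<in> carrier K" "z \<in> carrier K"
  shows "conjugate E (b, y) (c, z) = (C y z b c, z)"
proof -
  interpret E: group E by (rule group_E)
  have "C y z b c \<otimes> \<sigma> z b \<otimes> f z y
      = b \<otimes> \<sigma> y c \<otimes> f y z \<otimes> (\<sigma> z b \<otimes> inv (\<sigma> z b)) \<otimes> (f z y \<otimes> inv (f z y))"
    unfolding ext_C_def by (simp only: assms \<sigma>_simps f_closed H.m_ac H.m_closed H.inv_closed)
  then have "(C y z b c, z) \<otimes>\<^bsub>E\<^esub> (b, y) = (b, y) \<otimes>\<^bsub>E\<^esub> (c, z)"
    by (simp add: E_mult K.m_comm)
  then show ?thesis
    unfolding conjugate_def by (intro E.inv_solve_right'[THEN iffD2])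
      (simp_all add: E_carrier E_mult)
qed

end

section \<open>The bracket on the extension\<close>

locale lie_ring_extension = cocycle_extension +
  assumes h_normal: "\<And>x. x \<in> carrier K \<Longrightarrow> h x \<one>\<^bsub>K\<^esub> = \<one> \<and> h \<one>\<^bsub>K\<^esub> x = \<one> \<and> h x x = \<one>"
    and \<sigma>_star: "\<And>x y a b. \<lbrakk>x \<in> carrier K; y \<in> carrier K; a \<in> carrier H; b \<in> carrier H\<rbrakk> \<Longrightarrow>
        \<sigma> (x \<star>\<^bsub>K\<^esub> y) (a \<star> b) = a \<star> b"
    and left_cond: "\<And>x y z b c. \<lbrakk>x \<in> carrier K; y \<in> carrier K; z \<in> carrier K;
          b \<in> carrier H; c \<in> carrier H\<rbrakk> \<Longrightarrow>
        c \<otimes> \<Gamma> (x \<otimes>\<^bsub>K\<^esub> y) c \<otimes> f x y \<otimes> ((\<sigma> x b \<otimes> f x y) \<star> c)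
          \<otimes> \<sigma> ((x \<otimes>\<^bsub>K\<^esub> y) \<star>\<^bsub>K\<^esub> z)
              (\<sigma> x (inv b) \<otimes> inv (f x y) \<otimes> \<Gamma> z (\<sigma> x (inv b) \<otimes> inv (f x y)))
          \<otimes> h (x \<otimes>\<^bsub>K\<^esub> y) z
        = \<sigma> x (c \<otimes> \<Gamma> y c \<otimes> (b \<star> c)
              \<otimes> \<sigma> (y \<star>\<^bsub>K\<^esub> z) (inv b \<otimes> inv c \<otimes> \<Gamma> z (inv b)) \<otimes> h y z)
          \<otimes> f x (y \<star>\<^bsub>K\<^esub> z) \<otimes> inv (f (y \<star>\<^bsub>K\<^esub> z) x)
          \<otimes> \<sigma> (y \<star>\<^bsub>K\<^esub> z) (c \<otimes> \<Gamma> x c \<otimes> h x z)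
          \<otimes> f (y \<star>\<^bsub>K\<^esub> z) (x \<star>\<^bsub>K\<^esub> z)"
    and right_cond: "\<And>x y z a c. \<lbrakk>x \<in> carrier K; y \<in> carrier K; z \<in> carrier K;
          a \<in> carrier H; c \<in> carrier H\<rbrakk> \<Longrightarrow>
        \<sigma> y c \<otimes> f y z \<otimes> \<Gamma> x (\<sigma> y c \<otimes> f y z) \<otimes> (a \<star> (\<sigma> y c \<otimes> f y z))
          \<otimes> \<sigma> (x \<star>\<^bsub>K\<^esub> (y \<otimes>\<^bsub>K\<^esub> z))
              (inv a \<otimes> \<sigma> y (inv c) \<otimes> inv (f y z) \<otimes> \<Gamma> (y \<otimes>\<^bsub>K\<^esub> z) (inv a))
          \<otimes> h x (y \<otimes>\<^bsub>K\<^esub> z)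
        = \<sigma> (x \<star>\<^bsub>K\<^esub> y)
            (inv a \<otimes> \<Gamma> y (inv a)
              \<otimes> \<sigma> y (a \<otimes> c \<otimes> \<Gamma> x c \<otimes> (a \<star> c)
                  \<otimes> \<sigma> (x \<star>\<^bsub>K\<^esub> z) (inv a \<otimes> inv c \<otimes> \<Gamma> z (inv a)) \<otimes> h x z)
              \<otimes> f y (x \<star>\<^bsub>K\<^esub> z) \<otimes> inv (f (x \<star>\<^bsub>K\<^esub> z) y))
          \<otimes> f (x \<star>\<^bsub>K\<^esub> y) (x \<star>\<^bsub>K\<^esub> z) \<otimes> h x y"
    and conjugate_cond: "\<And>x y z a b c. \<lbrakk>x \<in> carrier K; y \<in> carrier K; z \<in> carrier K;
          a \<in> carrier H; b \<in> carrier H; c \<in> carrier H\<rbrakk> \<Longrightarrow>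
        (let P = c \<otimes> \<sigma> z a \<otimes> f z x \<otimes> inv (f x z) \<otimes> \<sigma> x (inv c);
             Q = c \<otimes> \<sigma> z b \<otimes> f z y \<otimes> inv (f y z) \<otimes> \<sigma> y (inv c)
         in \<sigma> z (\<Gamma> x b \<otimes> (a \<star> b)
                \<otimes> \<sigma> (x \<star>\<^bsub>K\<^esub> y) (inv a \<otimes> inv b \<otimes> \<Gamma> y (inv a)) \<otimes> h x y)
              \<otimes> f z (x \<star>\<^bsub>K\<^esub> y) \<otimes> inv (f (x \<star>\<^bsub>K\<^esub> y) z)
            = c \<otimes> f z x \<otimes> inv (f x z) \<otimes> f z y \<otimes> inv (f y z)
              \<otimes> \<sigma> x (inv c) \<otimes> \<sigma> y (inv c) \<otimes> \<Gamma> x Q \<otimes> (P \<star> Q)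
              \<otimes> \<sigma> (x \<star>\<^bsub>K\<^esub> y)
                  (inv c \<otimes> \<sigma> z (inv a \<otimes> inv b) \<otimes> inv (f z x) \<otimes> f x z
                    \<otimes> inv (f z y) \<otimes> f y z \<otimes> \<sigma> x c \<otimes> \<sigma> y c \<otimes> \<Gamma> y (inv P))
              \<otimes> h x y)"
    and jacobi_cond: "\<And>x y z a b c. \<lbrakk>x \<in> carrier K; y \<in> carrier K; z \<in> carrier K;
          a \<in> carrier H; b \<in> carrier H; c \<in> carrier H\<rbrakk> \<Longrightarrow>
        (let J = ext_J H K \<sigma> \<Gamma> f h;
             p = (x \<star>\<^bsub>K\<^esub> y) \<star>\<^bsub>K\<^esub> z;
             q = (y \<star>\<^bsub>K\<^esub> z) \<star>\<^bsub>K\<^esub> x;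
             r = (z \<star>\<^bsub>K\<^esub> x) \<star>\<^bsub>K\<^esub> y
         in J x y z a b c \<otimes> \<sigma> p (J y z x b c a) \<otimes> f p q
              \<otimes> \<sigma> (p \<otimes>\<^bsub>K\<^esub> q) (J z x y c a b) \<otimes> f (p \<otimes>\<^bsub>K\<^esub> q) r = \<one>)"
begin

lemma M_self:
  assumes [simp]: "x \<in> carrier K" "a \<in> carrier H"
  shows "M x x a a = \<one>"
proof -
  have "M x x a a = (a \<otimes> a \<otimes> \<Gamma> x a) \<otimes> inv (a \<otimes> a \<otimes> \<Gamma> x a)"
    unfolding ext_M_def by (simp add: h_normal \<sigma>_one H.inv_mult)
  then show ?thesis by simp
qed

text \<open>
  On the right-hand side, \<open>C x s a\<close> contributes \<open>inv (\<sigma> s a)\<close> and \<open>\<sigma> s (M x z a c)\<close> contributes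
  \<open>\<sigma> s a\<close>. They cancel, and what remains of \<open>a\<close> is the factor that a general \<open>a\<close> adds to the case
  \<open>a = \<one>\<close> on the left-hand side as well.
\<close>

lemma M_mult_left:
  fixes x y z a b c
  defines "s \<equiv> y \<star>\<^bsub>K\<^esub> z" and "t \<equiv> x \<star>\<^bsub>K\<^esub> z"
  assumes [simp]: "x \<in> carrier K" "y \<in> carrier K" "z \<in> carrier K"
    "a \<in> carrier H" "b \<in> carrier H" "c \<in> carrier H"
  shows "M (x \<otimes>\<^bsub>K\<^esub> y) z (a \<otimes> \<sigma> x b \<otimes> f x y) c
    = C x s a (M y z b c) \<otimes> \<sigma> s (M x z a c) \<otimes> f s t"
proof -
  have [simp]: "s \<in> carrier K" "t \<in> carrier K" by (simp_all add: s_def t_def)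
  have st: "(x \<otimes>\<^bsub>K\<^esub> y) \<star>\<^bsub>K\<^esub> z = s \<otimes>\<^bsub>K\<^esub> t"
    by (simp add: s_def t_def K.star_mult_distrib_left K.m_comm)
  note cond = left_cond[of x y z b c, unfolded st, folded s_def t_def]
  \<comment> \<open>The factors by which the left-hand side exceeds that of \<open>left_cond\<close>.\<close>
  let ?k = "a \<otimes> \<sigma> x b \<otimes> (a \<star> c) \<otimes> \<sigma> (s \<otimes>\<^bsub>K\<^esub> t) (inv a \<otimes> inv c \<otimes> \<Gamma> z (inv a))"
  have "M (x \<otimes>\<^bsub>K\<^esub> y) z (a \<otimes> \<sigma> x b \<otimes> f x y) c = ?k \<otimes>
      (c \<otimes> \<Gamma> (x \<otimes>\<^bsub>K\<^esub> y) c \<otimes> f x y \<otimes> ((\<sigma> x b \<otimes> f x y) \<star> c)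
        \<otimes> \<sigma> (s \<otimes>\<^bsub>K\<^esub> t) (\<sigma> x (inv b) \<otimes> inv (f x y) \<otimes> \<Gamma> z (\<sigma> x (inv b) \<otimes> inv (f x y)))
        \<otimes> h (x \<otimes>\<^bsub>K\<^esub> y) z)"
    unfolding ext_M_def st by (simp add: H.star_mult_distrib_left H.inv_mult H.m_ac)
  also have "\<dots> = ?k \<otimes>
      (\<sigma> x (c \<otimes> \<Gamma> y c \<otimes> (b \<star> c) \<otimes> \<sigma> s (inv b \<otimes> inv c \<otimes> \<Gamma> z (inv b)) \<otimes> h y z)
        \<otimes> f x s \<otimes> inv (f s x) \<otimes> \<sigma> s (c \<otimes> \<Gamma> x c \<otimes> h x z) \<otimes> f s t)"
    by (subst cond) simp_all
  also have "\<dots> = C x s a (M y z b c) \<otimes> \<sigma> s (M x z a c) \<otimes> f s t"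
  proof -
    let ?U = "a \<otimes> \<sigma> x b
      \<otimes> \<sigma> x (c \<otimes> \<Gamma> y c \<otimes> (b \<star> c) \<otimes> \<sigma> s (inv b \<otimes> inv c \<otimes> \<Gamma> z (inv b)) \<otimes> h y z)
      \<otimes> f x s \<otimes> inv (f s x)"
    let ?V = "\<sigma> s (c \<otimes> \<Gamma> x c \<otimes> h x z) \<otimes> (a \<star> c)
      \<otimes> \<sigma> (s \<otimes>\<^bsub>K\<^esub> t) (inv a \<otimes> inv c \<otimes> \<Gamma> z (inv a))"
    have "C x s a (M y z b c) = inv (\<sigma> s a) \<otimes> ?U"
      unfolding ext_C_def ext_M_def s_def[symmetric] by (simp add: H.m_ac)
    \<comment> \<open>Here \<open>\<sigma>_star\<close> takes \<open>a \<star> c\<close> out of \<open>\<sigma> s\<close>, since \<open>s\<close> is a bracket in \<open>K\<close>.\<close>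
    moreover have "\<sigma> s (M x z a c) = \<sigma> s a \<otimes> ?V"
      using \<sigma>_star[of y z a c]
      unfolding ext_M_def t_def[symmetric] s_def[symmetric] by (simp add: \<sigma>_\<sigma> H.m_ac)
    ultimately have "C x s a (M y z b c) \<otimes> \<sigma> s (M x z a c) = ?U \<otimes> ?V"
      by (simp only:) (rule H.cancel_inv_mult; simp)
    then show ?thesis by (simp add: H.m_ac)
  qed
  finally show ?thesis .
qed

text \<open>
  As for the left factor, but now \<open>inv (\<sigma> s b)\<close> comes from the bracket \<open>M x y a b\<close> and \<open>\<sigma> s b\<close>
  from the conjugate.
\<close>

lemma M_mult_right:
  fixes x y z a b c
  defines "s \<equiv> x \<star>\<^bsub>K\<^esub> y" and "t \<equiv> x \<star>\<^bsub>K\<^esub> z"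
  assumes [simp]: "x \<in> carrier K" "y \<in> carrier K" "z \<in> carrier K"
    "a \<in> carrier H" "b \<in> carrier H" "c \<in> carrier H"
  shows "M x (y \<otimes>\<^bsub>K\<^esub> z) a (b \<otimes> \<sigma> y c \<otimes> f y z)
    = M x y a b \<otimes> \<sigma> s (C y t b (M x z a c)) \<otimes> f s t"
proof -
  have [simp]: "s \<in> carrier K" "t \<in> carrier K" by (simp_all add: s_def t_def)
  have st: "x \<star>\<^bsub>K\<^esub> (y \<otimes>\<^bsub>K\<^esub> z) = s \<otimes>\<^bsub>K\<^esub> t"
    by (simp add: s_def t_def K.star_mult_distrib_right)
  let ?N = "M x z a c"
  note cond = right_cond[of x y z a c, unfolded st, folded ext_M_def, folded s_def t_def]
  \<comment> \<open>The factors by which the left-hand side exceeds that of \<open>right_cond\<close>.\<close>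
  let ?k = "a \<otimes> b \<otimes> \<Gamma> x b \<otimes> (a \<star> b) \<otimes> \<sigma> (s \<otimes>\<^bsub>K\<^esub> t) (inv b)"
  have "M x (y \<otimes>\<^bsub>K\<^esub> z) a (b \<otimes> \<sigma> y c \<otimes> f y z) = ?k \<otimes>
      (\<sigma> y c \<otimes> f y z \<otimes> \<Gamma> x (\<sigma> y c \<otimes> f y z) \<otimes> (a \<star> (\<sigma> y c \<otimes> f y z))
        \<otimes> \<sigma> (s \<otimes>\<^bsub>K\<^esub> t) (inv a \<otimes> \<sigma> y (inv c) \<otimes> inv (f y z) \<otimes> \<Gamma> (y \<otimes>\<^bsub>K\<^esub> z) (inv a))
        \<otimes> h x (y \<otimes>\<^bsub>K\<^esub> z))"
    unfolding ext_M_def st by (simp add: H.star_mult_distrib_right H.inv_mult H.m_ac)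
  also have "\<dots> = ?k \<otimes>
      (\<sigma> s (inv a \<otimes> \<Gamma> y (inv a) \<otimes> \<sigma> y ?N \<otimes> f y t \<otimes> inv (f t y)) \<otimes> f s t \<otimes> h x y)"
    by (subst cond) simp_all
  also have "\<dots> = M x y a b \<otimes> \<sigma> s (C y t b ?N) \<otimes> f s t"
  proof -
    let ?U = "a \<otimes> b \<otimes> \<Gamma> x b \<otimes> (a \<star> b) \<otimes> \<sigma> s (inv a \<otimes> \<Gamma> y (inv a)) \<otimes> h x y"
    let ?V = "\<sigma> s (\<sigma> y ?N \<otimes> f y t \<otimes> inv (f t y)) \<otimes> \<sigma> (s \<otimes>\<^bsub>K\<^esub> t) (inv b)"
    have "M x y a b = inv (\<sigma> s b) \<otimes> ?U"
      unfolding ext_M_def s_def[symmetric] by (simp add: H.m_ac)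
    moreover have "\<sigma> s (C y t b ?N) = \<sigma> s b \<otimes> ?V"
      unfolding ext_C_def by (simp add: \<sigma>_\<sigma> H.m_ac)
    ultimately have "M x y a b \<otimes> \<sigma> s (C y t b ?N) = ?U \<otimes> ?V"
      by (simp only:) (rule H.cancel_inv_mult; simp)
    then show ?thesis by (simp add: H.m_ac)
  qed
  finally show ?thesis .
qed

text \<open>
  The elements \<open>P\<close> and \<open>Q\<close> in \<open>conjugate_cond\<close> are the \<open>H\<close>-coordinates of the conjugates of \<open>(a, x)\<close>
  and \<open>(b, y)\<close> by \<open>(c, z)\<close>. Their bracket involves \<open>P \<otimes> Q\<close> and \<open>inv P \<otimes> inv Q\<close>, which contain \<open>c\<close>
  and \<open>inv c\<close>, respectively, twice: one copy of each belongs to the condition, the other to the factor that has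
  been cancelled from it.
\<close>

lemma C_M_distrib:
  fixes x y z a b c
  defines "s \<equiv> x \<star>\<^bsub>K\<^esub> y"
  assumes [simp]: "x \<in> carrier K" "y \<in> carrier K" "z \<in> carrier K"
    "a \<in> carrier H" "b \<in> carrier H" "c \<in> carrier H"
  shows "C z s c (M x y a b) = M x y (C z x c a) (C z y c b)"
proof -
  have [simp]: "s \<in> carrier K" by (simp add: s_def)
  define P where "P = C z x c a"
  define Q where "Q = C z y c b"
  have [simp]: "P \<in> carrier H" "Q \<in> carrier H" by (simp_all add: P_def Q_def)
  have P: "c \<otimes> \<sigma> z a \<otimes> f z x \<otimes> inv (f x z) \<otimes> \<sigma> x (inv c) = P"
    by (simp add: P_def ext_C_def H.m_ac)
  have Q: "c \<otimes> \<sigma> z b \<otimes> f z y \<otimes> inv (f y z) \<otimes> \<sigma> y (inv c) = Q"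
    by (simp add: Q_def ext_C_def H.m_ac)
  note cond = conjugate_cond[of x y z a b c, unfolded Let_def P Q, folded s_def]
  let ?R = "c \<otimes> f z x \<otimes> inv (f x z) \<otimes> f z y \<otimes> inv (f y z) \<otimes> \<sigma> x (inv c) \<otimes> \<sigma> y (inv c)"
  let ?S = "inv c \<otimes> \<sigma> z (inv a \<otimes> inv b) \<otimes> inv (f z x) \<otimes> f x z
      \<otimes> inv (f z y) \<otimes> f y z \<otimes> \<sigma> x c \<otimes> \<sigma> y c"
  let ?k = "c \<otimes> \<sigma> z a \<otimes> \<sigma> z b \<otimes> inv (\<sigma> s c)"
  have PQ: "P \<otimes> Q = c \<otimes> \<sigma> z a \<otimes> \<sigma> z b \<otimes> ?R"
    by (simp add: H.m_ac flip: P Q)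
  have inv_PQ: "inv P \<otimes> inv Q = inv c \<otimes> ?S"
    by (simp add: H.inv_mult H.m_ac flip: P Q)
  have "C z s c (M x y a b) = ?k \<otimes>
      (\<sigma> z (\<Gamma> x b \<otimes> (a \<star> b) \<otimes> \<sigma> s (inv a \<otimes> inv b \<otimes> \<Gamma> y (inv a)) \<otimes> h x y)
        \<otimes> f z s \<otimes> inv (f s z))"
    unfolding ext_C_def ext_M_def s_def[symmetric] by (simp add: H.m_ac)
  also have "\<dots> = ?k \<otimes> (?R \<otimes> \<Gamma> x Q \<otimes> (P \<star> Q) \<otimes> \<sigma> s (?S \<otimes> \<Gamma> y (inv P)) \<otimes> h x y)"
    by (subst cond) simp_all
  also have "\<dots> = (c \<otimes> \<sigma> z a \<otimes> \<sigma> z b \<otimes> ?R) \<otimes> \<Gamma> x Q \<otimes> (P \<star> Q)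
      \<otimes> \<sigma> s ((inv c \<otimes> ?S) \<otimes> \<Gamma> y (inv P)) \<otimes> h x y"
    by (simp add: H.m_ac)
  also have "\<dots> = M x y P Q"
    unfolding PQ[symmetric] inv_PQ[symmetric] by (simp only: ext_M_def s_def)
  finally show ?thesis by (simp only: P_def Q_def)
qed

lemma star_star_conjugate_E:
  assumes [simp]: "x \<in> carrier K" "y \<in> carrier K" "z \<in> carrier K"
    "a \<in> carrier H" "b \<in> carrier H" "c \<in> carrier H"
  shows "((a, x) \<star>\<^bsub>E\<^esub> (b, y)) \<star>\<^bsub>E\<^esub> conjugate E (b, y) (c, z)
    = (J x y z a b c, (x \<star>\<^bsub>K\<^esub> y) \<star>\<^bsub>K\<^esub> z)"
proof -
  define m where "m = M x y a b"
  define n where "n = C y z b c"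
  have [simp]: "m \<in> carrier H" "n \<in> carrier H" by (simp_all add: m_def n_def)
  have "M (x \<star>\<^bsub>K\<^esub> y) z m n = J x y z a b c"
    unfolding ext_J_def Let_def m_def[symmetric] n_def[symmetric]
    unfolding ext_M_def by (simp add: H.m_ac)
  then show ?thesis
    by (simp add: conjugate_E E_star m_def n_def)
qed

theorem multiplicative_Lie_algebra_E: "multiplicative_Lie_algebra E"
proof (intro multiplicative_Lie_algebra.intro multiplicative_Lie_algebra_axioms.intro)
  show "group E" by (rule group_E)
next
  fix u v assume "u \<in> carrier E" "v \<in> carrier E"
  then show "u \<star>\<^bsub>E\<^esub> v \<in> carrier E"
    by (auto simp: E_carrier E_star)
next
  fix u assume "u \<in> carrier E"
  then show "u \<star>\<^bsub>E\<^esub> u = \<one>\<^bsub>E\<^esub>"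
    by (auto simp: E_carrier E_star E_one M_self)
next
  fix u v w assume "u \<in> carrier E" "v \<in> carrier E" "w \<in> carrier E"
  then obtain a x b y c z where
    [simp]: "u = (a, x)" "v = (b, y)" "w = (c, z)"
      "a \<in> carrier H" "b \<in> carrier H" "c \<in> carrier H"
      "x \<in> carrier K" "y \<in> carrier K" "z \<in> carrier K"
    by (auto simp: E_carrier)
  show "u \<star>\<^bsub>E\<^esub> (v \<otimes>\<^bsub>E\<^esub> w) = (u \<star>\<^bsub>E\<^esub> v) \<otimes>\<^bsub>E\<^esub> conjugate E v (u \<star>\<^bsub>E\<^esub> w)"
    by (simp add: E_mult E_star conjugate_E M_mult_right K.star_mult_distrib_right)
  show "(u \<otimes>\<^bsub>E\<^esub> v) \<star>\<^bsub>E\<^esub> w = conjugate E u (v \<star>\<^bsub>E\<^esub> w) \<otimes>\<^bsub>E\<^esub> (u \<star>\<^bsub>E\<^esub> w)"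
    by (simp add: E_mult E_star conjugate_E M_mult_left K.star_mult_distrib_left K.m_comm)
  show "conjugate E w (u \<star>\<^bsub>E\<^esub> v) = conjugate E w u \<star>\<^bsub>E\<^esub> conjugate E w v"
    by (simp add: E_star conjugate_E C_M_distrib)
  show "((u \<star>\<^bsub>E\<^esub> v) \<star>\<^bsub>E\<^esub> conjugate E v w) \<otimes>\<^bsub>E\<^esub> ((v \<star>\<^bsub>E\<^esub> w) \<star>\<^bsub>E\<^esub> conjugate E w u)
      \<otimes>\<^bsub>E\<^esub> ((w \<star>\<^bsub>E\<^esub> u) \<star>\<^bsub>E\<^esub> conjugate E u v) = \<one>\<^bsub>E\<^esub>"
    using jacobi_cond[of x y z a b c]
    by (simp add: star_star_conjugate_E E_mult E_one K.star_jacobi_abelian Let_def)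
qed

end

theorem theorem4p4:
  fixes H :: "('a, 'm) mult_lie_scheme" (structure)
    and K :: "('b, 'n) mult_lie_scheme"
    and \<sigma> \<Gamma> :: "'b \<Rightarrow> 'a \<Rightarrow> 'a"
    and f h :: "'b \<Rightarrow> 'b \<Rightarrow> 'a"
  assumes H: "Lie_ring H" and K: "Lie_ring K"
    and \<sigma>: "\<sigma> \<in> hom K (AutoGroup H)"
    and \<Gamma>: "\<Gamma> \<in> carrier K \<rightarrow> hom H H"
    and f: "f \<in> carrier K \<rightarrow> carrier K \<rightarrow> carrier H"
    and h: "h \<in> carrier K \<rightarrow> carrier K \<rightarrow> carrier H"
    and A1: "\<And>x. x \<in> carrier K \<Longrightarrow> f \<one>\<^bsub>K\<^esub> x = \<one> \<and> f x \<one>\<^bsub>K\<^esub> = \<one>"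
    and A2: "\<And>x y z. \<lbrakk>x \<in> carrier K; y \<in> carrier K; z \<in> carrier K\<rbrakk> \<Longrightarrow>
        f x y \<otimes> f (x \<otimes>\<^bsub>K\<^esub> y) z = \<sigma> x (f y z) \<otimes> f x (y \<otimes>\<^bsub>K\<^esub> z)"
    and B: "\<And>x. x \<in> carrier K \<Longrightarrow> h x \<one>\<^bsub>K\<^esub> = \<one> \<and> h \<one>\<^bsub>K\<^esub> x = \<one> \<and> h x x = \<one>"
    and C: "\<And>x y a b. \<lbrakk>x \<in> carrier K; y \<in> carrier K; a \<in> carrier H; b \<in> carrier H\<rbrakk> \<Longrightarrow>
        \<sigma> (x \<star>\<^bsub>K\<^esub> y) (a \<star> b) = a \<star> b"
    and D: "\<And>x y z b c. \<lbrakk>x \<in> carrier K; y \<in> carrier K; z \<in> carrier K;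
          b \<in> carrier H; c \<in> carrier H\<rbrakk> \<Longrightarrow>
        c \<otimes> \<Gamma> (x \<otimes>\<^bsub>K\<^esub> y) c \<otimes> f x y \<otimes> ((\<sigma> x b \<otimes> f x y) \<star> c)
          \<otimes> \<sigma> ((x \<otimes>\<^bsub>K\<^esub> y) \<star>\<^bsub>K\<^esub> z)
              (\<sigma> x (inv b) \<otimes> inv (f x y) \<otimes> \<Gamma> z (\<sigma> x (inv b) \<otimes> inv (f x y)))
          \<otimes> h (x \<otimes>\<^bsub>K\<^esub> y) z
        = \<sigma> x (c \<otimes> \<Gamma> y c \<otimes> (b \<star> c)
              \<otimes> \<sigma> (y \<star>\<^bsub>K\<^esub> z) (inv b \<otimes> inv c \<otimes> \<Gamma> z (inv b)) \<otimes> h y z)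
          \<otimes> f x (y \<star>\<^bsub>K\<^esub> z) \<otimes> inv (f (y \<star>\<^bsub>K\<^esub> z) x)
          \<otimes> \<sigma> (y \<star>\<^bsub>K\<^esub> z) (c \<otimes> \<Gamma> x c \<otimes> h x z)
          \<otimes> f (y \<star>\<^bsub>K\<^esub> z) (x \<star>\<^bsub>K\<^esub> z)"
    and E: "\<And>x y z a c. \<lbrakk>x \<in> carrier K; y \<in> carrier K; z \<in> carrier K;
          a \<in> carrier H; c \<in> carrier H\<rbrakk> \<Longrightarrow>
        \<sigma> y c \<otimes> f y z \<otimes> \<Gamma> x (\<sigma> y c \<otimes> f y z) \<otimes> (a \<star> (\<sigma> y c \<otimes> f y z))
          \<otimes> \<sigma> (x \<star>\<^bsub>K\<^esub> (y \<otimes>\<^bsub>K\<^esub> z))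
              (inv a \<otimes> \<sigma> y (inv c) \<otimes> inv (f y z) \<otimes> \<Gamma> (y \<otimes>\<^bsub>K\<^esub> z) (inv a))
          \<otimes> h x (y \<otimes>\<^bsub>K\<^esub> z)
        = \<sigma> (x \<star>\<^bsub>K\<^esub> y)
            (inv a \<otimes> \<Gamma> y (inv a)
              \<otimes> \<sigma> y (a \<otimes> c \<otimes> \<Gamma> x c \<otimes> (a \<star> c)
                  \<otimes> \<sigma> (x \<star>\<^bsub>K\<^esub> z) (inv a \<otimes> inv c \<otimes> \<Gamma> z (inv a)) \<otimes> h x z)
              \<otimes> f y (x \<star>\<^bsub>K\<^esub> z) \<otimes> inv (f (x \<star>\<^bsub>K\<^esub> z) y))
          \<otimes> f (x \<star>\<^bsub>K\<^esub> y) (x \<star>\<^bsub>K\<^esub> z) \<otimes> h x y"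
    and F: "\<And>x y z a b c. \<lbrakk>x \<in> carrier K; y \<in> carrier K; z \<in> carrier K;
          a \<in> carrier H; b \<in> carrier H; c \<in> carrier H\<rbrakk> \<Longrightarrow>
        (let P = c \<otimes> \<sigma> z a \<otimes> f z x \<otimes> inv (f x z) \<otimes> \<sigma> x (inv c);
             Q = c \<otimes> \<sigma> z b \<otimes> f z y \<otimes> inv (f y z) \<otimes> \<sigma> y (inv c)
         in \<sigma> z (\<Gamma> x b \<otimes> (a \<star> b)
                \<otimes> \<sigma> (x \<star>\<^bsub>K\<^esub> y) (inv a \<otimes> inv b \<otimes> \<Gamma> y (inv a)) \<otimes> h x y)
              \<otimes> f z (x \<star>\<^bsub>K\<^esub> y) \<otimes> inv (f (x \<star>\<^bsub>K\<^esub> y) z)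
            = c \<otimes> f z x \<otimes> inv (f x z) \<otimes> f z y \<otimes> inv (f y z)
              \<otimes> \<sigma> x (inv c) \<otimes> \<sigma> y (inv c) \<otimes> \<Gamma> x Q \<otimes> (P \<star> Q)
              \<otimes> \<sigma> (x \<star>\<^bsub>K\<^esub> y)
                  (inv c \<otimes> \<sigma> z (inv a \<otimes> inv b) \<otimes> inv (f z x) \<otimes> f x z
                    \<otimes> inv (f z y) \<otimes> f y z \<otimes> \<sigma> x c \<otimes> \<sigma> y c \<otimes> \<Gamma> y (inv P))
              \<otimes> h x y)"
    and G: "\<And>x y z a b c. \<lbrakk>x \<in> carrier K; y \<in> carrier K; z \<in> carrier K;
          a \<in> carrier H; b \<in> carrier H; c \<in> carrier H\<rbrakk> \<Longrightarrow>
        (let J = ext_J H K \<sigma> \<Gamma> f h;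
             p = (x \<star>\<^bsub>K\<^esub> y) \<star>\<^bsub>K\<^esub> z;
             q = (y \<star>\<^bsub>K\<^esub> z) \<star>\<^bsub>K\<^esub> x;
             r = (z \<star>\<^bsub>K\<^esub> x) \<star>\<^bsub>K\<^esub> y
         in J x y z a b c \<otimes> \<sigma> p (J y z x b c a) \<otimes> f p q
              \<otimes> \<sigma> (p \<otimes>\<^bsub>K\<^esub> q) (J z x y c a b) \<otimes> f (p \<otimes>\<^bsub>K\<^esub> q) r = \<one>)"
  shows "multiplicative_Lie_algebra (ext_mult_lie H K \<sigma> \<Gamma> f h)"
proof -
  interpret lie_ring_extension H K \<sigma> \<Gamma> f h
    using assms by (intro lie_ring_extension.intro cocycle_extension.intro
        cocycle_extension_axioms.intro lie_ring_extension_axioms.intro)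
  show ?thesis by (rule multiplicative_Lie_algebra_E)
qed

end
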